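(* Let $(G,\circ)$ and $(K,\ast)$ be finite groups. If $|G|\leq |K|$ and $(G,\circ)$ is not isomorphic to a subgroup of $(K,\ast)$, then the overlap between $(G,\circ)$ and $(K,\ast)$ is at most $\frac{7}{9}|G|^2$.
   Context: For finite groups $(G,\circ)$ and $(K,\ast)$, the overlap between $(G,\circ)$ and $(K,\ast)$ is defined as $$\max_{\gamma:G\hookrightarrow S,\ \kappa:K\hookrightarrow S} \#\left\{(x,y)\in G\times G:\ \exists (x',y')\in K\times K \text{ such that } \gamma(x)=\kappa(x'),\ \gamma(y)=\kappa(y'),\ \gamma(x\circ y)=\kappa(x'\ast y')\right\},$$ where $S$ is any set with $|S|\geq \max(|G|,|K|)$, and the maximum is over all pairs of injective maps of sets $\gamma:G\hookrightarrow S$ and $\kappa:K\hookrightarrow S$ (not required to respect any group structure). *)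

theory Defs
  imports Complex_Main "HOL-Algebra.Algebra"
begin

definition agreement ::
  "('a, 'm) monoid_scheme \<Rightarrow> ('b, 'n) monoid_scheme \<Rightarrow> ('a \<Rightarrow> 'c) \<Rightarrow> ('b \<Rightarrow> 'c) \<Rightarrow> ('a \<times> 'a) set" where
  "agreement G K \<gamma> \<kappa> =
    {(x, y) \<in> carrier G \<times> carrier G.
      \<exists>(x', y') \<in> carrier K \<times> carrier K.
        \<gamma> x = \<kappa> x' \<and> \<gamma> y = \<kappa> y' \<and> \<gamma> (x \<otimes>\<^bsub>G\<^esub> y) = \<kappa> (x' \<otimes>\<^bsub>K\<^esub> y')}"

definition overlap_values ::
  "'c set \<Rightarrow> ('a, 'm) monoid_scheme \<Rightarrow> ('b, 'n) monoid_scheme \<Rightarrow> nat set" where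
  "overlap_values S G K =
    {card (agreement G K \<gamma> \<kappa>) | \<gamma> \<kappa>.
      \<gamma> \<in> carrier G \<rightarrow> S \<and> inj_on \<gamma> (carrier G) \<and>
      \<kappa> \<in> carrier K \<rightarrow> S \<and> inj_on \<kappa> (carrier K)}"

text \<open>An infinite \<open>S\<close> is allowed; since \<open>card\<close> of an infinite set is 0, this case needs
  its own disjunct.\<close>

definition large_enough ::
  "'c set \<Rightarrow> ('a, 'm) monoid_scheme \<Rightarrow> ('b, 'n) monoid_scheme \<Rightarrow> bool" where
  "large_enough S G K \<longleftrightarrow> infinite S \<or> card S \<ge> max (order G) (order K)"

definition overlap ::
  "'c set \<Rightarrow> ('a, 'm) monoid_scheme \<Rightarrow> ('b, 'n) monoid_scheme \<Rightarrow> nat" where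
  "overlap S G K = Max (overlap_values S G K)"

text \<open>\<open>Max\<close> of an empty or infinite set is unspecified; the lemmas
  \<open>finite_overlap_values\<close> and \<open>overlap_values_nonempty\<close> exclude both for finite groups and
  large enough \<open>S\<close>.\<close>

lemma finite_overlap_values:
  fixes S :: "'c set" and G :: "('a, 'm) monoid_scheme" and K :: "('b, 'n) monoid_scheme"
  assumes "finite (carrier G)"
  shows "finite (overlap_values S G K)"
proof (rule finite_subset)
  have "agreement G K \<gamma> \<kappa> \<subseteq> carrier G \<times> carrier G" for \<gamma> :: "'a \<Rightarrow> 'c" and \<kappa>
    by (auto simp: agreement_def)
  then have "card (agreement G K \<gamma> \<kappa>) \<le> card (carrier G \<times> carrier G)" for \<gamma> :: "'a \<Rightarrow> 'c" and \<kappa>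
    using assms by (intro card_mono) auto
  then show "overlap_values S G K \<subseteq> {..card (carrier G \<times> carrier G)}"
    unfolding overlap_values_def by blast
qed simp

lemma injection_into_large_set:
  assumes "finite A" and "infinite S \<or> card A \<le> card S"
  shows "\<exists>f. f \<in> A \<rightarrow> S \<and> inj_on f A"
proof -
  have "\<exists>T. finite T \<and> T \<subseteq> S \<and> card A \<le> card T"
  proof (cases "finite S")
    case True
    then show ?thesis using assms(2) by auto
  next
    case False
    from infinite_arbitrarily_large[OF this, of "card A"] show ?thesis by auto
  qed
  then obtain T where T: "finite T" "T \<subseteq> S" "card A \<le> card T"
    by blast
  obtain f where "inj_on f A" "f ` A \<subseteq> T"
    using inj_on_iff_card_le[OF assms(1) T(1)] T(3) by blast
  then show ?thesis
    using T(2) by blast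
qed

lemma overlap_values_nonempty:
  assumes "finite (carrier G)" "finite (carrier K)" "large_enough S G K"
  shows "overlap_values S G K \<noteq> {}"
proof -
  obtain \<gamma> where "\<gamma> \<in> carrier G \<rightarrow> S" "inj_on \<gamma> (carrier G)"
    using injection_into_large_set[of "carrier G" S] assms
    by (auto simp: large_enough_def order_def)
  moreover obtain \<kappa> where "\<kappa> \<in> carrier K \<rightarrow> S" "inj_on \<kappa> (carrier K)"
    using injection_into_large_set[of "carrier K" S] assms
    by (auto simp: large_enough_def order_def)
  ultimately show ?thesis
    unfolding overlap_values_def by blast
qed

end

(* Extend the partial map \<kappa>^-1 \<gamma> to an injection f : G \<rightarrow> K and suppose that f(xy) = f(x) f(y) for more
   than 7/9 of all pairs. For each x, the map y \<mapsto> f(xy) f(y)^-1 takes equal values on more than 5/9 of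
   all pairs (y, yw), because f(y)^-1 f(yw) and f(xy)^-1 f(xyw) usually both equal f(w). As
   p^2 + (1 - p)^2 > 5/9 forces p > 2/3, this map has one value \<phi>(x) on more than 2/3 of G. Given x
   and y, the three events "f(xyz) f(z)^-1 = \<phi>(xy)", "f(yz) f(z)^-1 = \<phi>(y)" and
   "f(xyz) f(yz)^-1 = \<phi>(x)" therefore hold for a common z, so \<phi> is a homomorphism. Its kernel is
   trivial since f is injective. This is the argument of Ben-Or, Coppersmith, Luby and Rubinfeld
   for testing non-abelian homomorphisms. *)

theory Submission
  imports Defs
begin

section \<open>Majority values and intersections of large subsets\<close>

text \<open>Let the most frequent value have density p. Each element disagrees with at least a share
  1 - p of \<open>A\<close>, so p > 5/9. The pairs with exactly one entry in the largest class give
  2p(1 - p) < 4/9, so p lies outside [1/3, 2/3]. Together these leave p > 2/3.\<close>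

lemma majority_value_if_few_disagreements:
  fixes h :: "'a \<Rightarrow> 'v"
  assumes fin: "finite A"
    and few: "9 * card {(y, z) \<in> A \<times> A. h y \<noteq> h z} < 4 * (card A)\<^sup>2"
  shows "\<exists>v. 2 * card A < 3 * card {y \<in> A. h y = v}"
proof -
  define n where "n = card A"
  define m where "m v = card {y \<in> A. h y = v}" for v
  have n: "n > 0"
    using few unfolding n_def by (cases "card A = 0") auto
  then have ne: "A \<noteq> {}"
    unfolding n_def by auto
  \<comment> \<open>\<open>h a\<close> is a most frequent value of \<open>h\<close>, and
    \<open>V\<close> below is its class.\<close>
  obtain a where a: "a \<in> A" "\<And>y. y \<in> A \<Longrightarrow> m (h y) \<le> m (h a)"
  proof -
    have "Max ((m \<circ> h) ` A) \<in> (m \<circ> h) ` A"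
      using fin ne by (intro Max_in) auto
    then obtain a where "a \<in> A" "Max ((m \<circ> h) ` A) = m (h a)"
      by auto
    with that fin show ?thesis
      by (metis Max_ge comp_apply finite_imageI imageI)
  qed
  define V where "V = {y \<in> A. h y = h a}"
  define M where "M = card V"
  have V: "V \<subseteq> A" "finite V"
    using fin by (auto simp: V_def)
  have Mn: "M \<le> n"
    unfolding M_def n_def using V fin by (simp add: card_mono)
  have mM: "m (h y) \<le> M" if "y \<in> A" for y
    using a(2)[OF that] by (simp add: m_def M_def V_def)
  have compl: "card {z \<in> A. h y \<noteq> h z} = n - m (h y)" for y
  proof -
    have "{z \<in> A. h y \<noteq> h z} = A - {z \<in> A. h z = h y}"
      by auto
    then show ?thesis
      unfolding n_def m_def using fin by (simp add: card_Diff_subset)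
  qed
  have "{(y, z) \<in> A \<times> A. h y \<noteq> h z} = (SIGMA y:A. {z \<in> A. h y \<noteq> h z})"
    by auto
  then have "card {(y, z) \<in> A \<times> A. h y \<noteq> h z} = (\<Sum>y\<in>A. card {z \<in> A. h y \<noteq> h z})"
    using fin by simp
  then have dis: "card {(y, z) \<in> A \<times> A. h y \<noteq> h z} = (\<Sum>y\<in>A. n - m (h y))"
    by (simp add: compl)
  have b1: "n * (n - M) \<le> (\<Sum>y\<in>A. n - m (h y))"
    using sum_mono[of A "\<lambda>_. n - M" "\<lambda>y. n - m (h y)"] mM n_def by (simp add: diff_le_mono2)
  \<comment> \<open>Elements of \<open>V\<close> disagree with everything outside \<open>V\<close>,
    and elements outside \<open>V\<close> with all of \<open>V\<close>; each direction contributes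
    M(n - M) ordered pairs.\<close>
  have b2: "2 * (M * (n - M)) \<le> (\<Sum>y\<in>A. n - m (h y))"
  proof -
    have "M * (n - M) \<le> (\<Sum>y\<in>V. n - m (h y))"
      using sum_mono[of V "\<lambda>_. n - M" "\<lambda>y. n - m (h y)"] mM V
      by (simp add: M_def diff_le_mono2 subset_iff)
    moreover have "(n - M) * M \<le> (\<Sum>y\<in>A - V. n - m (h y))"
    proof -
      have "M \<le> n - m (h y)" if "y \<in> A - V" for y
        unfolding compl[symmetric] M_def using that fin
        by (intro card_mono) (auto simp: V_def)
      then have "(\<Sum>y\<in>A - V. M) \<le> (\<Sum>y\<in>A - V. n - m (h y))"
        by (intro sum_mono)
      then show ?thesis
        using V fin by (simp add: n_def M_def card_Diff_subset)
    qed
    moreover have "(\<Sum>y\<in>A. n - m (h y)) = (\<Sum>y\<in>V. n - m (h y)) + (\<Sum>y\<in>A - V. n - m (h y))"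
      using V fin by (metis add.commute sum.subset_diff)
    ultimately show ?thesis
      by (simp add: mult.commute)
  qed
  have "2 * n < 3 * M"
  proof -
    \<comment> \<open>Over the integers the subtraction is no longer truncated, so the quadratic can
      be factored.\<close>
    define N D where "N = int n" and "D = int M"
    have ND: "0 < N" "D \<le> N" "int (n - M) = N - D"
      using n Mn by (auto simp: N_def D_def of_nat_diff)
    have "9 * (n * (n - M)) < 4 * n\<^sup>2" "9 * (2 * (M * (n - M))) < 4 * n\<^sup>2"
      using few dis b1 b2 unfolding n_def[symmetric] by linarith+
    then have "int (9 * (n * (n - M))) < int (4 * n\<^sup>2)"
      "int (9 * (2 * (M * (n - M)))) < int (4 * n\<^sup>2)"
      by (simp_all only: of_nat_less_iff)
    then have "9 * (N * (N - D)) < 4 * N\<^sup>2" and q: "18 * (D * (N - D)) < 4 * N\<^sup>2"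
      using ND(3) by (simp_all add: N_def D_def)
    then have "N * (5 * N) < N * (9 * D)"
      by (simp add: power2_eq_square algebra_simps)
    then have "5 * N < 9 * D"
      using ND(1) by simp
    then have "0 < 3 * D - N"
      using ND(1) by simp
    \<comment> \<open>This is \<open>q\<close> rearranged: 9D^2 - 9DN + 2N^2 > 0. The bound 5N < 9D
      has already made the first factor positive.\<close>
    moreover have "0 < (3 * D - N) * (3 * D - 2 * N)"
      using q by (simp add: power2_eq_square algebra_simps)
    ultimately have "0 < 3 * D - 2 * N"
      using zero_less_mult_pos by blast
    then show ?thesis
      by (simp add: N_def D_def)
  qed
  then show ?thesis
    unfolding M_def V_def n_def by blast
qed

text \<open>Each complement contains less than a third of \<open>A\<close>, so three of them cannot
  cover \<open>A\<close>.\<close>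

lemma three_large_sets_meet:
  assumes fin: "finite A" and sub: "P \<subseteq> A" "Q \<subseteq> A" "R \<subseteq> A"
    and large: "2 * card A < 3 * card P" "2 * card A < 3 * card Q" "2 * card A < 3 * card R"
  shows "P \<inter> Q \<inter> R \<noteq> {}"
proof
  assume "P \<inter> Q \<inter> R = {}"
  then have "A = (A - P) \<union> (A - Q) \<union> (A - R)"
    by auto
  then have "card A \<le> card (A - P) + card (A - Q) + card (A - R)"
    by (metis (no_types, lifting) add_le_mono1 card_Un_le le_trans)
  moreover have "card (A - P) = card A - card P" "card (A - Q) = card A - card Q"
    "card (A - R) = card A - card R"
    using sub fin by (simp_all add: card_Diff_subset finite_subset)
  moreover have "card P \<le> card A" "card Q \<le> card A" "card R \<le> card A"
    using sub fin by (simp_all add: card_mono)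
  ultimately show False
    using large by linarith
qed

section \<open>Almost multiplicative maps between groups\<close>

lemma (in group) card_left_translate:
  assumes "y \<in> carrier G"
  shows "card {z \<in> carrier G. P (y \<otimes> z)} = card {z \<in> carrier G. P z}"
proof (rule bij_betw_same_card)
  show "bij_betw ((\<otimes>) y) {z \<in> carrier G. P (y \<otimes> z)} {z \<in> carrier G. P z}"
    using assms
    by (intro bij_betw_byWitness[where f' = "(\<otimes>) (inv y)"]) (auto simp: m_assoc[symmetric])
qed

text \<open>Write z = yw. If \<open>f\<close> is multiplicative at both (y, w) and (xy, w), then
  f(w) cancels and \<open>h y = h z\<close>. A disagreement thus comes from a failure at one of
  these two pairs, whence the factor 2.\<close>

lemma quotient_values_rarely_disagree:
  fixes G :: "('a, 'm) monoid_scheme" and K :: "('b, 'n) monoid_scheme"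
  assumes "group G" "group K" and fin: "finite (carrier G)"
    and f: "f \<in> carrier G \<rightarrow> carrier K" and x: "x \<in> carrier G"
  defines "h \<equiv> \<lambda>y. f (x \<otimes>\<^bsub>G\<^esub> y) \<otimes>\<^bsub>K\<^esub> inv\<^bsub>K\<^esub> f y"
  shows "card {(y, z) \<in> carrier G \<times> carrier G. h y \<noteq> h z}
    \<le> 2 * card {(y, z) \<in> carrier G \<times> carrier G. f (y \<otimes>\<^bsub>G\<^esub> z) \<noteq> f y \<otimes>\<^bsub>K\<^esub> f z}"
    (is "card ?N \<le> 2 * card ?B")
proof -
  interpret G: group G by fact
  interpret K: group K by fact
  \<comment> \<open>Both maps recover (y, yw): \<open>?g\<close> from the pair (y, w),
    \<open>?g'\<close> from the pair (xy, w).\<close>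
  let ?g = "\<lambda>(y, w). (y, y \<otimes>\<^bsub>G\<^esub> w)" and ?g' = "\<lambda>(u, w). (inv\<^bsub>G\<^esub> x \<otimes>\<^bsub>G\<^esub> u, inv\<^bsub>G\<^esub> x \<otimes>\<^bsub>G\<^esub> (u \<otimes>\<^bsub>G\<^esub> w))"
  have finB: "finite ?B"
    by (rule finite_subset[of _ "carrier G \<times> carrier G"]) (use fin in auto)
  have "?N \<subseteq> ?g ` ?B \<union> ?g' ` ?B"
  proof (clarify, rule ccontr)
    fix y z
    assume yz: "y \<in> carrier G" "z \<in> carrier G" "h y \<noteq> h z"
      and out: "(y, z) \<notin> ?g' ` ?B"  "(y, z) \<notin> ?g ` ?B"
    define w where "w = inv\<^bsub>G\<^esub> y \<otimes>\<^bsub>G\<^esub> z"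
    have w: "w \<in> carrier G" "z = y \<otimes>\<^bsub>G\<^esub> w"
      using yz by (auto simp: w_def G.m_assoc[symmetric])
    have 1: "f z = f y \<otimes>\<^bsub>K\<^esub> f w"
    proof (rule ccontr)
      assume "f z \<noteq> f y \<otimes>\<^bsub>K\<^esub> f w"
      then have "(y, w) \<in> ?B" using yz w by auto
      then have "?g (y, w) \<in> ?g ` ?B" by (rule imageI)
      then show False using out w by simp
    qed
    have 2: "f (x \<otimes>\<^bsub>G\<^esub> z) = f (x \<otimes>\<^bsub>G\<^esub> y) \<otimes>\<^bsub>K\<^esub> f w"
    proof (rule ccontr)
      assume "f (x \<otimes>\<^bsub>G\<^esub> z) \<noteq> f (x \<otimes>\<^bsub>G\<^esub> y) \<otimes>\<^bsub>K\<^esub> f w"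
      then have "(x \<otimes>\<^bsub>G\<^esub> y, w) \<in> ?B" using yz w x by (auto simp: G.m_assoc)
      then have "?g' (x \<otimes>\<^bsub>G\<^esub> y, w) \<in> ?g' ` ?B" by (rule imageI)
      moreover have "?g' (x \<otimes>\<^bsub>G\<^esub> y, w) = (y, z)"
        using yz(1) w x by (simp add: G.m_assoc[symmetric])
      ultimately show False using out by simp
    qed
    have c: "f y \<in> carrier K" "f w \<in> carrier K" "f (x \<otimes>\<^bsub>G\<^esub> y) \<in> carrier K"
      using f x yz w by auto
    have "h z = f (x \<otimes>\<^bsub>G\<^esub> y) \<otimes>\<^bsub>K\<^esub> (f w \<otimes>\<^bsub>K\<^esub> (inv\<^bsub>K\<^esub> f w \<otimes>\<^bsub>K\<^esub> inv\<^bsub>K\<^esub> f y))"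
      unfolding h_def 1 2 using c by (simp add: K.inv_mult_group K.m_assoc)
    also have "\<dots> = h y"
      unfolding h_def using c by (simp add: K.m_assoc[symmetric])
    finally show False using yz by simp
  qed
  then have "card ?N \<le> card (?g ` ?B \<union> ?g' ` ?B)"
    using finB by (intro card_mono) auto
  also have "\<dots> \<le> card (?g ` ?B) + card (?g' ` ?B)"
    by (rule card_Un_le)
  also have "\<dots> \<le> card ?B + card ?B"
    using finB by (intro add_mono card_image_le)
  finally show ?thesis by simp
qed

lemma embedding_if_mostly_multiplicative:
  fixes G :: "('a, 'm) monoid_scheme" and K :: "('b, 'n) monoid_scheme"
  assumes "group G" "group K" and fin: "finite (carrier G)"
    and f: "f \<in> carrier G \<rightarrow> carrier K" "inj_on f (carrier G)"
    and most: "7 * (order G)\<^sup>2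
      < 9 * card {(x, y) \<in> carrier G \<times> carrier G. f (x \<otimes>\<^bsub>G\<^esub> y) = f x \<otimes>\<^bsub>K\<^esub> f y}"
  shows "\<exists>H. subgroup H K \<and> G \<cong> K\<lparr>carrier := H\<rparr>"
proof -
  interpret G: group G by fact
  interpret K: group K by fact
  let ?A = "{(x, y) \<in> carrier G \<times> carrier G. f (x \<otimes>\<^bsub>G\<^esub> y) = f x \<otimes>\<^bsub>K\<^esub> f y}"
  let ?B = "{(x, y) \<in> carrier G \<times> carrier G. f (x \<otimes>\<^bsub>G\<^esub> y) \<noteq> f x \<otimes>\<^bsub>K\<^esub> f y}"
  let ?n = "card (carrier G)"
  \<comment> \<open>The elements y that vote for v as the value of the homomorphism at x.\<close>
  define E where "E x v = {y \<in> carrier G. f (x \<otimes>\<^bsub>G\<^esub> y) \<otimes>\<^bsub>K\<^esub> inv\<^bsub>K\<^esub> f y = v}" for x v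
  have "?A \<union> ?B = carrier G \<times> carrier G" "?A \<inter> ?B = {}" "?A \<subseteq> carrier G \<times> carrier G"
    "?B \<subseteq> carrier G \<times> carrier G"
    by auto
  moreover have "finite (carrier G \<times> carrier G)"
    using fin by simp
  ultimately have "card ?A + card ?B = card (carrier G \<times> carrier G)"
    by (metis (lifting) card_Un_disjoint finite_subset)
  \<comment> \<open>Failures have density below 2/9; doubled, this is the threshold 4/9 of the
    majority lemma.\<close>
  then have few: "9 * card ?B < 2 * ?n\<^sup>2"
    using most by (simp add: card_cartesian_product order_def power2_eq_square)
  have "\<exists>v. 2 * ?n < 3 * card (E x v)" if "x \<in> carrier G" for x
    unfolding E_def
    using quotient_values_rarely_disagree[OF assms(1,2) fin f(1) that] few fin
    by (intro majority_value_if_few_disagreements) auto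
  then obtain \<phi> where \<phi>: "\<And>x. x \<in> carrier G \<Longrightarrow> 2 * ?n < 3 * card (E x (\<phi> x))"
    by metis
  \<comment> \<open>A single vote suffices to show that \<open>\<phi> x\<close> lies in
    \<open>K\<close> and that the kernel is trivial.\<close>
  have witness: "\<exists>y\<in>carrier G. f (x \<otimes>\<^bsub>G\<^esub> y) \<otimes>\<^bsub>K\<^esub> inv\<^bsub>K\<^esub> f y = \<phi> x" if "x \<in> carrier G" for x
  proof -
    have "E x (\<phi> x) \<noteq> {}"
      using \<phi>[OF that] by auto
    then show ?thesis
      by (auto simp: E_def)
  qed
  have closed: "\<phi> x \<in> carrier K" if x: "x \<in> carrier G" for x
  proof -
    obtain y where y: "y \<in> carrier G" "\<phi> x = f (x \<otimes>\<^bsub>G\<^esub> y) \<otimes>\<^bsub>K\<^esub> inv\<^bsub>K\<^esub> f y"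
      using witness[OF x] by metis
    have "f (x \<otimes>\<^bsub>G\<^esub> y) \<in> carrier K" "f y \<in> carrier K"
      using f(1) x y(1) by auto
    then show ?thesis
      using y(2) by simp
  qed
  have mult: "\<phi> (x \<otimes>\<^bsub>G\<^esub> y) = \<phi> x \<otimes>\<^bsub>K\<^esub> \<phi> y" if x: "x \<in> carrier G" and y: "y \<in> carrier G" for x y
  proof -
    \<comment> \<open>The vote for \<open>\<phi> x\<close> is cast by yz instead of z, so that f(yz)
      cancels in the product. Left translation preserves the number of such z.\<close>
    let ?T = "{z \<in> carrier G. y \<otimes>\<^bsub>G\<^esub> z \<in> E x (\<phi> x)}"
    have "card ?T = card (E x (\<phi> x))"
      using G.card_left_translate[OF y, of "\<lambda>z. z \<in> E x (\<phi> x)"] by (simp add: E_def)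
    then have "E (x \<otimes>\<^bsub>G\<^esub> y) (\<phi> (x \<otimes>\<^bsub>G\<^esub> y)) \<inter> E y (\<phi> y) \<inter> ?T \<noteq> {}"
      using \<phi> x y by (intro three_large_sets_meet[OF fin]) (auto simp: E_def)
    then obtain z where z: "z \<in> carrier G"
      "f (x \<otimes>\<^bsub>G\<^esub> y \<otimes>\<^bsub>G\<^esub> z) \<otimes>\<^bsub>K\<^esub> inv\<^bsub>K\<^esub> f z = \<phi> (x \<otimes>\<^bsub>G\<^esub> y)"
      "f (y \<otimes>\<^bsub>G\<^esub> z) \<otimes>\<^bsub>K\<^esub> inv\<^bsub>K\<^esub> f z = \<phi> y"
      "f (x \<otimes>\<^bsub>G\<^esub> (y \<otimes>\<^bsub>G\<^esub> z)) \<otimes>\<^bsub>K\<^esub> inv\<^bsub>K\<^esub> f (y \<otimes>\<^bsub>G\<^esub> z) = \<phi> x"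
      by (auto simp: E_def)
    have c: "f z \<in> carrier K" "f (y \<otimes>\<^bsub>G\<^esub> z) \<in> carrier K" "f (x \<otimes>\<^bsub>G\<^esub> (y \<otimes>\<^bsub>G\<^esub> z)) \<in> carrier K"
      using f(1) x y z(1) by auto
    have "inv\<^bsub>K\<^esub> f (y \<otimes>\<^bsub>G\<^esub> z) \<otimes>\<^bsub>K\<^esub> (f (y \<otimes>\<^bsub>G\<^esub> z) \<otimes>\<^bsub>K\<^esub> inv\<^bsub>K\<^esub> f z) = inv\<^bsub>K\<^esub> f z"
      using c by (simp add: K.m_assoc[symmetric])
    then have "\<phi> x \<otimes>\<^bsub>K\<^esub> \<phi> y = f (x \<otimes>\<^bsub>G\<^esub> (y \<otimes>\<^bsub>G\<^esub> z)) \<otimes>\<^bsub>K\<^esub> inv\<^bsub>K\<^esub> f z"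
      unfolding z(3,4)[symmetric] using c by (simp add: K.m_assoc)
    also have "\<dots> = \<phi> (x \<otimes>\<^bsub>G\<^esub> y)"
      unfolding z(2)[symmetric] using x y z(1) by (simp add: G.m_assoc)
    finally show ?thesis by simp
  qed
  have hom: "\<phi> \<in> hom G K"
    using closed mult by (auto simp: hom_def)
  interpret \<phi>: group_hom G K \<phi>
    by unfold_locales (rule hom)
  have "inj_on \<phi> (carrier G)"
  proof (rule \<phi>.trivial_ker_imp_inj)
    have "x = \<one>\<^bsub>G\<^esub>" if x: "x \<in> carrier G" "\<phi> x = \<one>\<^bsub>K\<^esub>" for x
    proof -
      obtain y where y: "y \<in> carrier G" "f (x \<otimes>\<^bsub>G\<^esub> y) \<otimes>\<^bsub>K\<^esub> inv\<^bsub>K\<^esub> f y = \<one>\<^bsub>K\<^esub>"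
        using witness[OF x(1)] x(2) by auto
      have "f (x \<otimes>\<^bsub>G\<^esub> y) \<in> carrier K" "f y \<in> carrier K"
        using f(1) x y by auto
      \<comment> \<open>With trivial quotient, injectivity of \<open>f\<close> gives xy = y and
        hence x = 1.\<close>
      then have "f (x \<otimes>\<^bsub>G\<^esub> y) = f y"
        using y(2) by (metis K.inv_closed K.inv_equality K.inv_inv)
      then have "x \<otimes>\<^bsub>G\<^esub> y = y"
        using f(2) x y by (simp add: inj_on_eq_iff)
      then show ?thesis
        using x y by simp
    qed
    then show "kernel G K \<phi> = {\<one>\<^bsub>G\<^esub>}"
      by (auto simp: kernel_def)
  qed
  then have "\<phi> \<in> iso G (K\<lparr>carrier := \<phi> ` carrier G\<rparr>)"
    using mult by (auto simp: iso_def hom_def bij_betw_def)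
  then show ?thesis
    using \<phi>.img_is_subgroup by (auto simp: is_iso_def)
qed

section \<open>From the overlap to an injection of G into K\<close>

lemma inj_on_extend:
  assumes fin: "finite A" "finite B" and "card A \<le> card B"
    and g: "D \<subseteq> A" "g ` D \<subseteq> B" "inj_on g D"
  obtains f where "f \<in> A \<rightarrow> B" "inj_on f A" "\<And>x. x \<in> D \<Longrightarrow> f x = g x"
proof -
  have "card (A - D) \<le> card (B - g ` D)"
    using assms by (simp add: card_Diff_subset card_image finite_subset)
  then obtain e where e: "inj_on e (A - D)" "e ` (A - D) \<subseteq> B - g ` D"
    using fin by (meson finite_Diff inj_on_iff_card_le)
  let ?f = "\<lambda>x. if x \<in> D then g x else e x"
  have "?f \<in> A \<rightarrow> B"
    using e g by (simp add: image_subset_iff)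
  moreover have "inj_on ?f A"
  proof (rule inj_onI)
    fix x y assume xy: "x \<in> A" "y \<in> A" "?f x = ?f y"
    have "e u \<noteq> g v" if "u \<in> A - D" "v \<in> D" for u v
      using e(2) that by blast
    with xy have "x \<in> D \<longleftrightarrow> y \<in> D"
      by (metis DiffI)
    with xy show "x = y"
      using e(1) g(3) by (cases "x \<in> D") (auto dest: inj_onD)
  qed
  ultimately show thesis
    by (intro that[of ?f]) auto
qed

text \<open>This eliminates \<open>S\<close>: the labels matter only through the partial injection
  \<kappa>^-1 \<gamma>. At an agreeing pair (x, y) it is defined at x, y and xy, and there any
  extension \<open>f\<close> satisfies f(xy) = x'y' = f(x) f(y).\<close>

lemma agreement_le_multiplicative_pairs:
  assumes fin: "finite (carrier G)" "finite (carrier K)" and le: "order G \<le> order K"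
    and \<gamma>: "inj_on \<gamma> (carrier G)" and \<kappa>: "inj_on \<kappa> (carrier K)" and "group G" "group K"
  obtains f where "f \<in> carrier G \<rightarrow> carrier K" "inj_on f (carrier G)"
    "card (agreement G K \<gamma> \<kappa>)
      \<le> card {(x, y) \<in> carrier G \<times> carrier G. f (x \<otimes>\<^bsub>G\<^esub> y) = f x \<otimes>\<^bsub>K\<^esub> f y}"
proof -
  interpret G: group G by fact
  interpret K: group K by fact
  \<comment> \<open>The domain of \<kappa>^-1 \<gamma>; outside it \<open>inv_into\<close> returns
    an arbitrary value, which the extension \<open>f\<close> replaces.\<close>
  define D where "D = {x \<in> carrier G. \<gamma> x \<in> \<kappa> ` carrier K}"
  define g where "g x = inv_into (carrier K) \<kappa> (\<gamma> x)" for x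
  have "D \<subseteq> carrier G" "g ` D \<subseteq> carrier K"
    by (auto simp: D_def g_def inv_into_into)
  moreover have "inj_on g D"
    using \<gamma> by (auto simp: inj_on_def D_def g_def inv_into_injective)
  ultimately obtain f where f: "f \<in> carrier G \<rightarrow> carrier K" "inj_on f (carrier G)"
    "\<And>x. x \<in> D \<Longrightarrow> f x = g x"
    using inj_on_extend[OF fin le[unfolded order_def], of D g] by metis
  have eq: "f x = x'" if "x \<in> carrier G" "x' \<in> carrier K" "\<gamma> x = \<kappa> x'" for x x'
    using that f(3)[of x] \<kappa> by (auto simp: D_def g_def)
  have "agreement G K \<gamma> \<kappa>
      \<subseteq> {(x, y) \<in> carrier G \<times> carrier G. f (x \<otimes>\<^bsub>G\<^esub> y) = f x \<otimes>\<^bsub>K\<^esub> f y}"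
    by (auto simp: agreement_def eq)
  moreover have "finite {(x, y) \<in> carrier G \<times> carrier G. f (x \<otimes>\<^bsub>G\<^esub> y) = f x \<otimes>\<^bsub>K\<^esub> f y}"
    by (rule finite_subset[of _ "carrier G \<times> carrier G"]) (use fin in auto)
  ultimately show thesis
    using that f card_mono by blast
qed

theorem corollary1:
  fixes G :: "('a, 'm) monoid_scheme" and K :: "('b, 'n) monoid_scheme" and S :: "'c set"
  assumes "group G" and "finite (carrier G)"
    and "group K" and "finite (carrier K)"
    and "order G \<le> order K"
    and "\<not> (\<exists>H. subgroup H K \<and> G \<cong> K\<lparr>carrier := H\<rparr>)"
    and "large_enough S G K"
  shows "real (overlap S G K) \<le> 7 / 9 * (real (order G))\<^sup>2"
proof -
  \<comment> \<open>The maximum is attained, so one concrete pair of labellings can be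
    studied.\<close>
  have "overlap S G K \<in> overlap_values S G K"
    unfolding overlap_def using assms
    by (intro Max_in finite_overlap_values overlap_values_nonempty)
  then obtain \<gamma> :: "'a \<Rightarrow> 'c" and \<kappa> :: "'b \<Rightarrow> 'c"
    where ov: "overlap S G K = card (agreement G K \<gamma> \<kappa>)"
      and inj: "inj_on \<gamma> (carrier G)" "inj_on \<kappa> (carrier K)"
    by (auto simp: overlap_values_def)
  obtain f where f: "f \<in> carrier G \<rightarrow> carrier K" "inj_on f (carrier G)"
    "overlap S G K \<le> card {(x, y) \<in> carrier G \<times> carrier G. f (x \<otimes>\<^bsub>G\<^esub> y) = f x \<otimes>\<^bsub>K\<^esub> f y}"
    using agreement_le_multiplicative_pairs[OF assms(2,4,5) inj assms(1,3)] unfolding ov by blast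
  have "\<not> 7 * (order G)\<^sup>2
      < 9 * card {(x, y) \<in> carrier G \<times> carrier G. f (x \<otimes>\<^bsub>G\<^esub> y) = f x \<otimes>\<^bsub>K\<^esub> f y}"
    using embedding_if_mostly_multiplicative[OF assms(1,3,2) f(1,2)] assms(6) by blast
  then have "9 * overlap S G K \<le> 7 * (order G)\<^sup>2"
    using f(3) by linarith
  then have "real (9 * overlap S G K) \<le> real (7 * (order G)\<^sup>2)"
    by (simp only: of_nat_le_iff)
  then show ?thesis
    by simp
qed

end
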